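(* Let $1\le p\le\infty$ and let $A,B:L_p(\mathbb{R},\mu)\to L_p(\mathbb{R},\mu)$ be the operators defined, for almost every $t$, by $$(Ax)(t)=\int_{\alpha_1}^{\beta_1}I_{[\alpha,\beta]}(t)\Big(\theta_{A,1}\sin(\omega t)\cos(\omega s)-\frac{1}{\delta\sigma_2}\cos(\omega t)\cos(\omega s)+\frac{1}{\delta\sigma_1}\sin(\omega t)\sin(\omega s)\Big)x(s)\,d\mu_s,$$ $$(Bx)(t)=\int_{\alpha_1}^{\beta_1}I_{[\alpha,\beta]}(t)\big(\theta_{B,1}\sin(\omega t)\cos(\omega s)+\theta_{B,3}\sin(\omega t)\sin(\omega s)\big)x(s)\,d\mu_s,$$ where $\theta_{A,1},\theta_{B,1},\theta_{B,3},\omega\in\mathbb{R}$, $\delta\in\mathbb{R}\setminus\{0\}$, $\alpha,\beta,\alpha_1,\beta_1\in\mathbb{R}$, $\alpha_1<\beta_1$, $\alpha\le\alpha_1$, $\beta\ge\beta_1$, either $\frac{\omega}{\pi}(\beta_1-\alpha_1)\in\mathbb{Z}$ or $\frac{\omega}{\pi}(\beta_1+\alpha_1)\in\mathbb{Z}$, and $\sigma_1\ne0$, $\sigma_2\neq0$. Let $\{\varsigma_n\}$ be a sequence of real numbers and let $B_n:L_p(\mathbb{R},\mu)\to L_p(\mathbb{R},\mu)$ be defined, for almost every $t$, by $$(B_nx)(t)=\int_{\alpha_1}^{\beta_1}I_{[\alpha,\beta]}(t)\big(\varsigma_n\sin(\omega t)\cos(\omega s)+\theta_{B,3}\sin(\omega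 t)\sin(\omega s)\big)x(s)\,d\mu_s.$$ Then: 1. $AB=\delta BA^2$ and $AB_n=\delta B_nA^2$ for each positive integer $n$. Moreover, for every $x\in L_p(\mathbb{R},\mu)$ and almost every $t$, $$(AB-BA)x(t)=\Big(\frac{2\theta_{B,1}}{\delta}-\theta_{A,1}\theta_{B,3}\sigma_1\Big)\int_{\alpha_1}^{\beta_1}I_{[\alpha,\beta]}(t)\sin(\omega t)\cos(\omega s)x(s)\,d\mu_s.$$ 2. If $\varsigma_n\to\frac{\delta}{2}\theta_{A,1}\theta_{B,3}\sigma_1$ as $n\to\infty$, then $B_n\to\tilde B$ in norm, where, for almost every $t$, $$(\tilde Bx)(t)=\int_{\alpha_1}^{\beta_1}I_{[\alpha,\beta]}(t)\Big(\frac{\delta}{2}\theta_{A,1}\theta_{B,3}\sigma_1\sin(\omega t)\cos(\omega s)+\theta_{B,3}\sin(\omega t)\sin(\omega s)\Big)x(s)\,d\mu_s.$$ Moreover, $AB_n-B_nA\to0$ in norm and $A\tilde B=\tilde BA$. 3. Let $\lambda_0\in\mathrm{cl}(\Lambda)$. If $\big(\frac{2\theta_{B,1}}{\delta}-\theta_{A,1}\theta_{B,3}\sigma_1\big)\tilde\lambda\to0$ when $(\theta_{A,1},\theta_{B,1},\theta_{B,3},\alpha_1,\beta_1,\alpha,\beta,\sigma_1,\sigma_2,\delta,\omega)\to\lambda_0$ within $\Lambda$, then for all $x\in L_p(\mathbb{R},\mu)$ it holds that $\|(AB-BA)x\|_{L_p}\to0$ (along the same limit of parameters, $A$ and $B$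 being the operators with these parameters).
   Context: $\mu$ is Lebesgue measure on $\mathbb{R}$; $L_p(\mathbb{R},\mu)$ is the real Lebesgue space; the index in $d\mu_s$ indicates the variable of integration; $I_E$ is the indicator function of the set $E$; convergence in norm means convergence in the operator norm on $L_p(\mathbb{R},\mu)$. The constants are $$\sigma_1=\int_{\alpha_1}^{\beta_1}(\sin(\omega s))^2d\mu_s,\qquad \sigma_2=\int_{\alpha_1}^{\beta_1}(\cos(\omega s))^2d\mu_s=\beta_1-\alpha_1-\sigma_1.$$ The parameter set is $$\Lambda=\Big\{(\theta_{A,1},\theta_{B,1},\theta_{B,3},\alpha_1,\beta_1,\alpha,\beta,\sigma_1,\sigma_2,\delta,\omega)\in\mathbb{R}^{11}:\ \delta\ne0,\ \alpha_1<\beta_1,\ \alpha\le\alpha_1,\ \beta\ge\beta_1,\ \int_{\alpha_1}^{\beta_1}\sin(\omega s)\cos(\omega s)d\mu_s=0,\ \sigma_1=\int_{\alpha_1}^{\beta_1}(\sin(\omega s))^2d\mu_s\ne0,\ \sigma_2=\beta_1-\alpha_1-\sigma_1\ne0\Big\},$$ and $\mathrm{cl}(\Lambda)$ is its closure in $\mathbb{R}^{11}$. Further, $\tilde\lambda=|\beta-\alpha|^{1/p}|\beta_1-\alpha_1|^{1/q}$ with $\frac1p+\frac1q=1$ if $1<p<\infty$, $\tilde\lambda=|\beta_1-\alpha_1|$ if $p=\infty$, and $\tilde\lambda=|\beta-\alpha|$ if $p=1$. *)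

theory Defs
  imports "HOL-Analysis.Analysis" "HOL-Probability.Essential_Supremum"
begin

text \<open>
  Elements of the real space \<open>L_p(\<real>, \<mu>)\<close>, \<open>1 \<le> p \<le> \<infinity>\<close>, are represented by Lebesgue measurable
  functions; equality of elements is equality almost everywhere.
\<close>

definition Lp_norm :: "ennreal \<Rightarrow> (real \<Rightarrow> real) \<Rightarrow> ennreal" where
  "Lp_norm p x =
     (if p = \<infinity> then esssup lebesgue (\<lambda>t. ennreal \<bar>x t\<bar>)
      else let J = (\<integral>\<^sup>+ t. ennreal (\<bar>x t\<bar> powr enn2real p) \<partial>lebesgue)
           in if J = \<infinity> then \<infinity> else ennreal (enn2real J powr (1 / enn2real p)))"

definition Lp :: "ennreal \<Rightarrow> (real \<Rightarrow> real) set" where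
  "Lp p = {x \<in> borel_measurable lebesgue. Lp_norm p x < \<infinity>}"

type_synonym fun_op = "(real \<Rightarrow> real) \<Rightarrow> real \<Rightarrow> real"

text \<open>A map on functions that induces a map from \<open>L_p\<close> to \<open>L_p\<close>.\<close>

definition Lp_operator :: "ennreal \<Rightarrow> fun_op \<Rightarrow> bool" where
  "Lp_operator p T \<longleftrightarrow>
     (\<forall>x\<in>Lp p. T x \<in> Lp p) \<and>
     (\<forall>x\<in>Lp p. \<forall>y\<in>Lp p. (AE t in lebesgue. x t = y t) \<longrightarrow> (AE t in lebesgue. T x t = T y t))"

definition Lp_op_eq :: "ennreal \<Rightarrow> fun_op \<Rightarrow> fun_op \<Rightarrow> bool" where
  "Lp_op_eq p S T \<longleftrightarrow> (\<forall>x\<in>Lp p. AE t in lebesgue. S x t = T x t)"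

definition op_scale :: "real \<Rightarrow> fun_op \<Rightarrow> fun_op" where
  "op_scale c T = (\<lambda>x t. c * T x t)"

definition op_diff :: "fun_op \<Rightarrow> fun_op \<Rightarrow> fun_op" where
  "op_diff S T = (\<lambda>x t. S x t - T x t)"

text \<open>The value is \<open>\<infinity>\<close> for an unbounded operator.\<close>

definition Lp_opnorm :: "ennreal \<Rightarrow> fun_op \<Rightarrow> ennreal" where
  "Lp_opnorm p T = (SUP x\<in>{x \<in> Lp p. Lp_norm p x \<le> 1}. Lp_norm p (T x))"

definition tendsto_in_norm :: "ennreal \<Rightarrow> (nat \<Rightarrow> fun_op) \<Rightarrow> fun_op \<Rightarrow> bool" where
  "tendsto_in_norm p T S \<longleftrightarrow> (\<lambda>n. Lp_opnorm p (op_diff (T n) S)) \<longlonglongrightarrow> 0"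

definition int_op :: "real \<Rightarrow> real \<Rightarrow> (real \<Rightarrow> real \<Rightarrow> real) \<Rightarrow> fun_op" where
  "int_op \<alpha>\<^sub>1 \<beta>\<^sub>1 K x t = (LINT s:{\<alpha>\<^sub>1..\<beta>\<^sub>1}|lebesgue. K t s * x s)"

text \<open>
  The numbers \<open>\<sigma>\<^sub>1\<close>, \<open>\<sigma>\<^sub>2\<close> are separate arguments of \<open>op_A\<close> because they are coordinates of the
  parameter vectors in \<open>param_set\<close> below.
\<close>

definition op_A ::
  "real \<Rightarrow> real \<Rightarrow> real \<Rightarrow> real \<Rightarrow> real \<Rightarrow> real \<Rightarrow> real \<Rightarrow> real \<Rightarrow> real \<Rightarrow> fun_op" where
  "op_A \<theta>A1 \<alpha>\<^sub>1 \<beta>\<^sub>1 \<alpha> \<beta> \<sigma>\<^sub>1 \<sigma>\<^sub>2 \<delta> \<omega> =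
     int_op \<alpha>\<^sub>1 \<beta>\<^sub>1 (\<lambda>t s. indicator {\<alpha>..\<beta>} t *
       (\<theta>A1 * sin (\<omega> * t) * cos (\<omega> * s)
        - 1 / (\<delta> * \<sigma>\<^sub>2) * cos (\<omega> * t) * cos (\<omega> * s)
        + 1 / (\<delta> * \<sigma>\<^sub>1) * sin (\<omega> * t) * sin (\<omega> * s)))"

definition op_B ::
  "real \<Rightarrow> real \<Rightarrow> real \<Rightarrow> real \<Rightarrow> real \<Rightarrow> real \<Rightarrow> real \<Rightarrow> fun_op" where
  "op_B \<theta>B1 \<theta>B3 \<alpha>\<^sub>1 \<beta>\<^sub>1 \<alpha> \<beta> \<omega> =
     int_op \<alpha>\<^sub>1 \<beta>\<^sub>1 (\<lambda>t s. indicator {\<alpha>..\<beta>} t *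
       (\<theta>B1 * sin (\<omega> * t) * cos (\<omega> * s) + \<theta>B3 * sin (\<omega> * t) * sin (\<omega> * s)))"

definition sigma1 :: "real \<Rightarrow> real \<Rightarrow> real \<Rightarrow> real" where
  "sigma1 \<alpha>\<^sub>1 \<beta>\<^sub>1 \<omega> = (LINT s:{\<alpha>\<^sub>1..\<beta>\<^sub>1}|lebesgue. (sin (\<omega> * s))\<^sup>2)"

definition sigma2 :: "real \<Rightarrow> real \<Rightarrow> real \<Rightarrow> real" where
  "sigma2 \<alpha>\<^sub>1 \<beta>\<^sub>1 \<omega> = (LINT s:{\<alpha>\<^sub>1..\<beta>\<^sub>1}|lebesgue. (cos (\<omega> * s))\<^sup>2)"

text \<open>
  The space \<open>\<real>\<^sup>1\<^sup>1\<close>, as an iterated product, which carries the Euclidean metric. The order of the coordinates is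
  \<open>(\<theta>A1, \<theta>B1, \<theta>B3, \<alpha>\<^sub>1, \<beta>\<^sub>1, \<alpha>, \<beta>, \<sigma>\<^sub>1, \<sigma>\<^sub>2, \<delta>, \<omega>)\<close>.
\<close>

type_synonym params =
  "real \<times> real \<times> real \<times> real \<times> real \<times> real \<times> real \<times> real \<times> real \<times> real \<times> real"

definition param_set :: "params set" where
  "param_set = {(\<theta>A1, \<theta>B1, \<theta>B3, \<alpha>\<^sub>1, \<beta>\<^sub>1, \<alpha>, \<beta>, \<sigma>\<^sub>1, \<sigma>\<^sub>2, \<delta>, \<omega>).
     \<delta> \<noteq> 0 \<and> \<alpha>\<^sub>1 < \<beta>\<^sub>1 \<and> \<alpha> \<le> \<alpha>\<^sub>1 \<and> \<beta> \<ge> \<beta>\<^sub>1 \<and>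
     (LINT s:{\<alpha>\<^sub>1..\<beta>\<^sub>1}|lebesgue. sin (\<omega> * s) * cos (\<omega> * s)) = 0 \<and>
     \<sigma>\<^sub>1 = (LINT s:{\<alpha>\<^sub>1..\<beta>\<^sub>1}|lebesgue. (sin (\<omega> * s))\<^sup>2) \<and> \<sigma>\<^sub>1 \<noteq> 0 \<and>
     \<sigma>\<^sub>2 = \<beta>\<^sub>1 - \<alpha>\<^sub>1 - \<sigma>\<^sub>1 \<and> \<sigma>\<^sub>2 \<noteq> 0}"

text \<open>For \<open>1 < p < \<infinity>\<close> the exponent \<open>q = r / (r - 1)\<close> is the solution of \<open>1/p + 1/q = 1\<close>.\<close>

definition lambda_tilde :: "ennreal \<Rightarrow> real \<Rightarrow> real \<Rightarrow> real \<Rightarrow> real \<Rightarrow> real" where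
  "lambda_tilde p \<alpha>\<^sub>1 \<beta>\<^sub>1 \<alpha> \<beta> =
     (if p = \<infinity> then \<bar>\<beta>\<^sub>1 - \<alpha>\<^sub>1\<bar>
      else if p = 1 then \<bar>\<beta> - \<alpha>\<bar>
      else let r = enn2real p; q = r / (r - 1)
           in \<bar>\<beta> - \<alpha>\<bar> powr (1 / r) * \<bar>\<beta>\<^sub>1 - \<alpha>\<^sub>1\<bar> powr (1 / q))"

end

theory Submission
  imports Defs
begin

text \<open>
  All operators involved have the form \<open>x \<mapsto> I\<^bsub>[\<alpha>,\<beta>]\<^esub> (u sin (\<omega> t) + v cos (\<omega> t))\<close>, where \<open>u\<close> and \<open>v\<close>
  are linear combinations of the two moments \<open>S x = \<integral> sin (\<omega> s) x(s) ds\<close> and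
  \<open>C x = \<integral> cos (\<omega> s) x(s) ds\<close> over \<open>[\<alpha>\<^sub>1,\<beta>\<^sub>1]\<close>. Since \<open>[\<alpha>\<^sub>1,\<beta>\<^sub>1] \<subseteq> [\<alpha>,\<beta>]\<close> and \<open>sin\<close>, \<open>cos\<close> are orthogonal
  on \<open>[\<alpha>\<^sub>1,\<beta>\<^sub>1]\<close>, the image of such an operator has moments \<open>S = u \<sigma>\<^sub>1\<close> and \<open>C = v \<sigma>\<^sub>2\<close>. Composition
  is therefore arithmetic on pairs of coefficients: \<open>A\<close> acts on moments by
  \<open>(S, C) \<mapsto> (\<sigma>\<^sub>1 \<theta>\<^sub>A\<^sub>1 C + S/\<delta>, - C/\<delta>)\<close>, so that \<open>A\<^sup>2\<close> acts as the scalar \<open>1/\<delta>\<^sup>2\<close>, while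
  \<open>A\<close> is multiplication by \<open>1/\<delta>\<close> on the sine line that contains the image of \<open>B\<close>.
  Hence \<open>AB = \<delta> B A\<^sup>2 = B/\<delta>\<close>, and the commutator is
  \<open>(2 \<theta>\<^sub>B\<^sub>1/\<delta> - \<theta>\<^sub>A\<^sub>1 \<theta>\<^sub>B\<^sub>3 \<sigma>\<^sub>1) C x\<close> times the truncated sine
  (lemmas \<open>twisted_commutation\<close> and \<open>commutator_eq\<close>).

  The convergence statements rest on one estimate: the operator \<open>x \<mapsto> k (C x) I\<^bsub>[\<alpha>,\<beta>]\<^esub> sin (\<omega> t)\<close> has
  norm at most \<open>\<bar>k\<bar>\<close> times \<open>lambda_tilde\<close> (lemma \<open>cos_moment_trig_norm_le\<close>). The factor
  \<open>\<bar>\<beta> - \<alpha>\<bar>\<^bsup>1/p\<^esup>\<close> bounds the norm of the truncated sine, and \<open>\<bar>\<beta>\<^sub>1 - \<alpha>\<^sub>1\<bar>\<^bsup>1/q\<^esup>\<close> is Hoelder's inequality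
  for \<open>C x\<close>. Both \<open>B\<^sub>n - B'\<close> and the commutators have this form, with \<open>k \<longlonglongrightarrow> 0\<close>.
\<close>

section \<open>Estimates in \<open>L\<^sub>p\<close> on a bounded interval\<close>

lemma Lp_measurable: "x \<in> Lp p \<Longrightarrow> x \<in> borel_measurable lebesgue"
  by (simp add: Lp_def)

lemma Lp_exponent_cases:
  fixes p :: ennreal
  assumes "1 \<le> p"
  obtains (infinite) "p = \<infinity>" | (finite) r where "p = ennreal r" "1 \<le> r" "p \<noteq> \<infinity>" "enn2real p = r"
proof (cases p)
  case (real r)
  then have "1 \<le> r" using assms by simp
  with real that(2) show ?thesis by simp
qed (use that(1) in simp)

text \<open>
  Hoelder's inequality against the constant function. The conventions \<open>enn2real \<infinity> = 0\<close> and \<open>1 / 0 = 0\<close>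
  make \<open>1 - 1 / enn2real p\<close> equal to \<open>1/q\<close> for every \<open>p\<close>, including \<open>p = \<infinity>\<close>. For \<open>p = r < \<infinity>\<close>,
  Young's inequality is integrated after \<open>\<bar>x\<bar>\<^bsup>r\<^esup>\<close> and the constant have been normalised to total mass 1.
\<close>

lemma nn_integral_le_Lp_norm:
  assumes p: "1 \<le> p" and x: "x \<in> Lp p" and ab: "a < b"
  shows "(\<integral>\<^sup>+ s. ennreal (indicator {a..b} s * \<bar>x s\<bar>) \<partial>lebesgue)
    \<le> ennreal ((b - a) powr (1 - 1 / enn2real p)) * Lp_norm p x"
proof -
  note [measurable] = Lp_measurable[OF x]
  have [measurable]: "{a..b} \<in> sets lebesgue" by simp
  have ind: "(\<integral>\<^sup>+ s. indicator {a..b} s \<partial>lebesgue) = ennreal (b - a)"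
    using ab by simp
  show ?thesis using p
  proof (cases p rule: Lp_exponent_cases)
    case infinite
    have "AE s in lebesgue. ennreal \<bar>x s\<bar> \<le> Lp_norm p x"
      using esssup_AE[of "\<lambda>t. ennreal \<bar>x t\<bar>" lebesgue] infinite by (simp add: Lp_norm_def)
    then have "AE s in lebesgue. ennreal (indicator {a..b} s * \<bar>x s\<bar>) \<le> Lp_norm p x * indicator {a..b} s"
      by eventually_elim (auto simp: indicator_def)
    then have "(\<integral>\<^sup>+ s. ennreal (indicator {a..b} s * \<bar>x s\<bar>) \<partial>lebesgue)
        \<le> (\<integral>\<^sup>+ s. Lp_norm p x * indicator {a..b} s \<partial>lebesgue)"
      by (rule nn_integral_mono_AE)
    also have "\<dots> = Lp_norm p x * ennreal (b - a)"
      by (simp add: nn_integral_cmult ind)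
    finally show ?thesis using infinite ab by (simp add: mult.commute)
  next
    case (finite r)
    let ?J = "\<integral>\<^sup>+ t. ennreal (\<bar>x t\<bar> powr r) \<partial>lebesgue"
    have fin: "?J < \<infinity>"
      using x finite by (auto simp: Lp_def Lp_norm_def Let_def top.not_eq_extremum split: if_splits)
    define J where "J = enn2real ?J"
    have J: "?J = ennreal J" "0 \<le> J" using fin by (auto simp: J_def)
    have N: "Lp_norm p x = ennreal (J powr (1 / r))"
      using fin finite by (simp add: Lp_norm_def J_def Let_def)
    show ?thesis
    proof (cases "J = 0")
      case True
      then have "AE t in lebesgue. ennreal (\<bar>x t\<bar> powr r) = 0"
        using J nn_integral_0_iff_AE[of "\<lambda>t. ennreal (\<bar>x t\<bar> powr r)" lebesgue] by simp
      then have "AE t in lebesgue. ennreal (indicator {a..b} t * \<bar>x t\<bar>) = 0"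
        by eventually_elim (use ab in \<open>auto simp: ennreal_eq_0_iff\<close>)
      then have "(\<integral>\<^sup>+ s. ennreal (indicator {a..b} s * \<bar>x s\<bar>) \<partial>lebesgue) = 0"
        by (subst nn_integral_0_iff_AE) auto
      then show ?thesis by simp
    next
      case False
      with J have J0: "0 < J" by simp
      define L where "L = b - a"
      have L0: "0 < L" using ab by (simp add: L_def)
      \<comment> \<open>\<open>K\<close> is the right-hand side of the claim; after the normalisation, Young's inequality
        has total mass \<open>1/r + (1 - 1/r) = 1\<close>, which leaves exactly \<open>K\<close>.\<close>
      define K where "K = J powr (1/r) * L powr (1 - 1/r)"
      have K0: "0 < K" using J0 L0 by (simp add: K_def)
      have pt: "\<bar>x s\<bar> \<le> K * (\<bar>x s\<bar> powr r / (r * J) + (1 - 1/r) / L)" for s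
      proof (cases "x s = 0")
        case True then show ?thesis using K0 L0 finite by simp
      next
        case False
        have "(\<bar>x s\<bar> powr r / J) powr (1/r) * (1 / L) powr (1 - 1/r)
            \<le> (1/r) * (\<bar>x s\<bar> powr r / J) + (1 - 1/r) * (1 / L)"
          using finite False J0 L0 by (intro Youngs_inequality_0) auto
        moreover have "(\<bar>x s\<bar> powr r / J) powr (1/r) * (1 / L) powr (1 - 1/r) = \<bar>x s\<bar> / K"
          using finite J0 L0 by (simp add: K_def powr_divide powr_powr)
        ultimately have "\<bar>x s\<bar> / K \<le> \<bar>x s\<bar> powr r / (r * J) + (1 - 1/r) / L"
          by simp
        then show ?thesis using K0 by (simp add: pos_divide_le_eq mult.commute)
      qed
      have "(\<integral>\<^sup>+ s. ennreal (indicator {a..b} s * \<bar>x s\<bar>) \<partial>lebesgue)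
          \<le> (\<integral>\<^sup>+ s. ennreal (K / (r * J)) * ennreal (\<bar>x s\<bar> powr r)
                + ennreal (K * (1 - 1/r) / L) * indicator {a..b} s \<partial>lebesgue)"
      proof (intro nn_integral_mono)
        fix s
        have nonneg: "0 \<le> K * \<bar>x s\<bar> powr r / (r * J)" "0 \<le> K * (1 - 1/r) / L"
          using K0 J0 L0 finite by auto
        have "indicator {a..b} s * \<bar>x s\<bar> \<le> K / (r * J) * \<bar>x s\<bar> powr r + K * (1 - 1/r) / L * indicator {a..b} s"
          using pt[of s] nonneg by (auto simp: indicator_def algebra_simps)
        also have "ennreal \<dots> = ennreal (K / (r * J)) * ennreal (\<bar>x s\<bar> powr r)
            + ennreal (K * (1 - 1/r) / L) * indicator {a..b} s"
          using K0 J0 L0 finite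
          by (subst ennreal_plus) (auto simp: ennreal_mult'[symmetric] indicator_def)
        finally show "ennreal (indicator {a..b} s * \<bar>x s\<bar>) \<le> ennreal (K / (r * J)) * ennreal (\<bar>x s\<bar> powr r)
            + ennreal (K * (1 - 1/r) / L) * indicator {a..b} s" by (simp add: ennreal_leI)
      qed
      also have "\<dots> = ennreal (K / (r * J)) * ?J + ennreal (K * (1 - 1/r) / L) * ennreal L"
        using ind by (subst nn_integral_add) (auto simp: nn_integral_cmult L_def)
      also have "\<dots> = ennreal (K / (r * J) * J + K * (1 - 1/r) / L * L)"
        using K0 J0 L0 finite J by (simp add: ennreal_mult'[symmetric] ennreal_plus[symmetric] del: ennreal_plus)
      also have "K / (r * J) * J + K * (1 - 1/r) / L * L = K"
        using J0 L0 finite by (simp add: field_simps)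
      finally show ?thesis
        using N finite by (simp add: K_def L_def ennreal_mult' mult.commute)
    qed
  qed
qed

lemma Lp_mult_set_integrable:
  assumes p: "1 \<le> p" and x: "x \<in> Lp p" and ab: "a < b"
    and \<phi>: "\<phi> \<in> borel_measurable borel" "\<And>s. \<bar>\<phi> s\<bar> \<le> 1"
  shows "set_integrable lebesgue {a..b} (\<lambda>s. \<phi> s * x s)"
    and "ennreal \<bar>LINT s:{a..b}|lebesgue. \<phi> s * x s\<bar>
      \<le> ennreal ((b - a) powr (1 - 1 / enn2real p)) * Lp_norm p x"
proof -
  note [measurable] = Lp_measurable[OF x]
  have [measurable]: "\<phi> \<in> borel_measurable lebesgue" "{a..b} \<in> sets lebesgue"
    using \<phi>(1) by (auto intro: measurable_completion)
  let ?f = "\<lambda>s. indicator {a..b} s *\<^sub>R (\<phi> s * x s)"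
  have "(\<integral>\<^sup>+ s. norm (?f s) \<partial>lebesgue) \<le> (\<integral>\<^sup>+ s. ennreal (indicator {a..b} s * \<bar>x s\<bar>) \<partial>lebesgue)"
    using \<phi>(2) by (intro nn_integral_mono ennreal_leI)
      (auto simp: indicator_def abs_mult intro: mult_left_le_one_le)
  also note nn_integral_le_Lp_norm[OF p x ab]
  finally have le: "(\<integral>\<^sup>+ s. norm (?f s) \<partial>lebesgue)
      \<le> ennreal ((b - a) powr (1 - 1 / enn2real p)) * Lp_norm p x" .
  also have "\<dots> < \<infinity>" using x by (simp add: Lp_def ennreal_mult_less_top)
  finally have int: "integrable lebesgue ?f"
    by (intro integrableI_bounded) auto
  then show "set_integrable lebesgue {a..b} (\<lambda>s. \<phi> s * x s)"
    by (simp add: set_integrable_def)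
  from integral_norm_bound_ennreal[OF int] le
  show "ennreal \<bar>LINT s:{a..b}|lebesgue. \<phi> s * x s\<bar>
      \<le> ennreal ((b - a) powr (1 - 1 / enn2real p)) * Lp_norm p x"
    by (auto simp: set_lebesgue_integral_def)
qed

lemma Lp_norm_le_of_bounded_support:
  assumes p: "1 \<le> p" and ab: "a < b" and M: "0 \<le> M"
    and g: "g \<in> borel_measurable lebesgue" "\<And>t. \<bar>g t\<bar> \<le> M * indicator {a..b} t"
  shows "Lp_norm p g \<le> ennreal (M * (b - a) powr (1 / enn2real p))"
  using p
proof (cases p rule: Lp_exponent_cases)
  case infinite
  note [measurable] = g(1)
  have "ennreal \<bar>g t\<bar> \<le> ennreal M" for t
    using g(2)[of t] M by (intro ennreal_leI) (cases "t \<in> {a..b}", auto)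
  then show ?thesis
    using infinite ab by (auto simp: Lp_norm_def intro!: esssup_I)
next
  case (finite r)
  let ?J = "\<integral>\<^sup>+ t. ennreal (\<bar>g t\<bar> powr r) \<partial>lebesgue"
  have "?J \<le> (\<integral>\<^sup>+ t. ennreal (M powr r) * indicator {a..b} t \<partial>lebesgue)"
  proof (intro nn_integral_mono)
    fix t
    show "ennreal (\<bar>g t\<bar> powr r) \<le> ennreal (M powr r) * indicator {a..b} t"
      using g(2)[of t] finite by (cases "t \<in> {a..b}") (auto intro!: ennreal_leI powr_mono2)
  qed
  also have "\<dots> = ennreal (M powr r * (b - a))"
    using ab by (simp add: nn_integral_cmult_indicator ennreal_mult')
  finally have J: "?J \<le> ennreal (M powr r * (b - a))" .
  then have fin: "?J \<noteq> \<infinity>" by (auto simp: top_unique)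
  have "enn2real ?J \<le> M powr r * (b - a)"
    using J ab by (intro enn2real_leI) auto
  then have "enn2real ?J powr (1/r) \<le> (M powr r * (b - a)) powr (1/r)"
    using finite by (intro powr_mono2) auto
  also have "\<dots> = M * (b - a) powr (1/r)"
    using M ab finite by (simp add: powr_mult powr_powr)
  finally show ?thesis
    using fin finite by (simp add: Lp_norm_def Let_def ennreal_leI)
qed

text \<open>
  The three cases of the definition are instances of one formula. At \<open>p = 1\<close> and \<open>p = \<infinity>\<close> a factor
  with exponent 0 disappears because the interval has positive length.
\<close>

lemma lambda_tilde_eq:
  assumes "1 \<le> p" "\<alpha>\<^sub>1 < \<beta>\<^sub>1" "\<alpha> < \<beta>"
  shows "lambda_tilde p \<alpha>\<^sub>1 \<beta>\<^sub>1 \<alpha> \<beta>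
    = (\<beta> - \<alpha>) powr (1 / enn2real p) * (\<beta>\<^sub>1 - \<alpha>\<^sub>1) powr (1 - 1 / enn2real p)"
  using assms(1)
proof (cases p rule: Lp_exponent_cases)
  case infinite
  then show ?thesis using assms by (simp add: lambda_tilde_def)
next
  case (finite r)
  then show ?thesis using assms
    by (cases "r = 1") (auto simp: lambda_tilde_def Let_def diff_divide_distrib)
qed

section \<open>Integrals of trigonometric products\<close>

lemma set_lebesgue_integral_FTC:
  fixes F f :: "real \<Rightarrow> real"
  assumes "a \<le> b" "continuous_on {a..b} f" "\<And>s. (F has_real_derivative f s) (at s)"
  shows "(LINT s:{a..b}|lebesgue. f s) = F b - F a"
proof -
  have "(f has_integral F b - F a) {a..b}"
    using assms(1,3)
    by (intro fundamental_theorem_of_calculus)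
       (auto simp: has_real_derivative_iff_has_vector_derivative[symmetric]
             intro: has_field_derivative_at_within)
  then show ?thesis
    using set_lebesgue_integral_eq_integral(2)[OF absolutely_integrable_continuous_real[OF assms(2)]]
    by (simp add: integral_unique)
qed

text \<open>
  The integral is \<open>sin (\<omega> (b - a)) sin (\<omega> (b + a)) / (2 \<omega>)\<close>, and either integrality condition makes
  one of the sines vanish.
\<close>

lemma sin_mult_cos_set_integral_eq_0:
  fixes a b \<omega> :: real
  assumes ab: "a \<le> b" and \<omega>: "\<omega> / pi * (b - a) \<in> \<int> \<or> \<omega> / pi * (b + a) \<in> \<int>"
  shows "(LINT s:{a..b}|lebesgue. sin (\<omega> * s) * cos (\<omega> * s)) = 0"
proof (cases "\<omega> = 0")
  case False
  have "(LINT s:{a..b}|lebesgue. sin (\<omega> * s) * cos (\<omega> * s))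
      = (sin (\<omega> * b))\<^sup>2 / (2 * \<omega>) - (sin (\<omega> * a))\<^sup>2 / (2 * \<omega>)"
    using False
    by (intro set_lebesgue_integral_FTC ab)
       (auto intro!: derivative_eq_intros continuous_intros)
  also have "\<dots> = sin (\<omega> * (b - a)) * sin (\<omega> * (b + a)) / (2 * \<omega>)"
  proof -
    have "sin (\<omega> * (b - a)) * sin (\<omega> * (b + a))
        = (sin (\<omega> * b) * cos (\<omega> * a))\<^sup>2 - (cos (\<omega> * b) * sin (\<omega> * a))\<^sup>2"
      by (simp add: right_diff_distrib distrib_left sin_add sin_diff power2_eq_square algebra_simps)
    also have "\<dots> = (sin (\<omega> * b))\<^sup>2 - (sin (\<omega> * a))\<^sup>2"
      by (simp add: power_mult_distrib cos_squared_eq algebra_simps)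
    finally show ?thesis by (simp add: diff_divide_distrib)
  qed
  also have "\<dots> = 0"
  proof -
    have "sin (\<omega> * d) = 0" if "\<omega> / pi * d \<in> \<int>" for d
      using that by (auto elim!: Ints_cases simp: sin_zero_iff_int2 field_simps)
    with \<omega> show ?thesis by auto
  qed
  finally show ?thesis .
qed (simp add: set_lebesgue_integral_def)

lemma sigma1_plus_sigma2:
  assumes "a \<le> b"
  shows "sigma1 a b \<omega> + sigma2 a b \<omega> = b - a"
proof -
  have "sigma1 a b \<omega> + sigma2 a b \<omega> = (LINT s:{a..b}|lebesgue. (sin (\<omega> * s))\<^sup>2 + (cos (\<omega> * s))\<^sup>2)"
    unfolding sigma1_def sigma2_def
    by (intro set_integral_add(2)[symmetric] absolutely_integrable_continuous_real continuous_intros)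
  also have "\<dots> = b - a"
    using assms by (simp add: set_lebesgue_integral_def)
  finally show ?thesis .
qed

section \<open>Operators determined by the sine and cosine moments\<close>

locale nested_intervals =
  fixes \<alpha>\<^sub>1 \<beta>\<^sub>1 \<alpha> \<beta> \<omega> :: real
  assumes less: "\<alpha>\<^sub>1 < \<beta>\<^sub>1" and lower: "\<alpha> \<le> \<alpha>\<^sub>1" and upper: "\<beta>\<^sub>1 \<le> \<beta>"
begin

definition sin_moment :: "(real \<Rightarrow> real) \<Rightarrow> real" where
  "sin_moment x = (LINT s:{\<alpha>\<^sub>1..\<beta>\<^sub>1}|lebesgue. sin (\<omega> * s) * x s)"

definition cos_moment :: "(real \<Rightarrow> real) \<Rightarrow> real" where
  "cos_moment x = (LINT s:{\<alpha>\<^sub>1..\<beta>\<^sub>1}|lebesgue. cos (\<omega> * s) * x s)"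

definition trig :: "real \<Rightarrow> real \<Rightarrow> real \<Rightarrow> real" where
  "trig u v t = indicator {\<alpha>..\<beta>} t * (u * sin (\<omega> * t) + v * cos (\<omega> * t))"

abbreviation "\<sigma>\<^sub>1 \<equiv> sigma1 \<alpha>\<^sub>1 \<beta>\<^sub>1 \<omega>"
abbreviation "\<sigma>\<^sub>2 \<equiv> sigma2 \<alpha>\<^sub>1 \<beta>\<^sub>1 \<omega>"

lemma outer_less: "\<alpha> < \<beta>"
  using less lower upper by linarith

lemma set_integrable_sin_cos:
  assumes "1 \<le> p" "x \<in> Lp p"
  shows "set_integrable lebesgue {\<alpha>\<^sub>1..\<beta>\<^sub>1} (\<lambda>s. sin (\<omega> * s) * x s)"
    and "set_integrable lebesgue {\<alpha>\<^sub>1..\<beta>\<^sub>1} (\<lambda>s. cos (\<omega> * s) * x s)"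
  using assms less by (auto intro!: Lp_mult_set_integrable)

text \<open>
  This is what makes the operators well defined on classes of functions modulo equality almost everywhere.
\<close>

lemma sin_cos_moment_cong_AE:
  assumes x: "x \<in> Lp p" and y: "y \<in> Lp p" and eq: "AE t in lebesgue. x t = y t"
  shows "sin_moment x = sin_moment y" "cos_moment x = cos_moment y"
proof -
  note [measurable] = Lp_measurable[OF x] Lp_measurable[OF y]
  have [measurable]: "(\<lambda>s. sin (\<omega> * s)) \<in> borel_measurable lebesgue"
    "(\<lambda>s. cos (\<omega> * s)) \<in> borel_measurable lebesgue" "{\<alpha>\<^sub>1..\<beta>\<^sub>1} \<in> sets lebesgue"
    by (auto intro!: measurable_completion)
  show "sin_moment x = sin_moment y" "cos_moment x = cos_moment y"
    unfolding sin_moment_def cos_moment_def set_lebesgue_integral_def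
    by (rule integral_cong_AE; use eq in \<open>auto elim!: eventually_mono\<close>)+
qed

lemma cos_moment_bound:
  assumes "1 \<le> p" "x \<in> Lp p"
  shows "ennreal \<bar>cos_moment x\<bar> \<le> ennreal ((\<beta>\<^sub>1 - \<alpha>\<^sub>1) powr (1 - 1 / enn2real p)) * Lp_norm p x"
  using assms less unfolding cos_moment_def by (intro Lp_mult_set_integrable(2)) auto

lemma trig_measurable: "trig u v \<in> borel_measurable lebesgue"
  unfolding trig_def by (intro measurable_completion) simp

lemma trig_norm_le:
  assumes "1 \<le> p"
  shows "Lp_norm p (trig u v) \<le> ennreal ((\<bar>u\<bar> + \<bar>v\<bar>) * (\<beta> - \<alpha>) powr (1 / enn2real p))"
proof (rule Lp_norm_le_of_bounded_support[OF assms outer_less _ trig_measurable])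
  fix t
  have "\<bar>u * sin (\<omega> * t) + v * cos (\<omega> * t)\<bar> \<le> \<bar>u\<bar> * \<bar>sin (\<omega> * t)\<bar> + \<bar>v\<bar> * \<bar>cos (\<omega> * t)\<bar>"
    by (metis abs_mult abs_triangle_ineq)
  also have "\<dots> \<le> \<bar>u\<bar> + \<bar>v\<bar>"
    by (intro add_mono mult_left_le) auto
  finally show "\<bar>trig u v t\<bar> \<le> (\<bar>u\<bar> + \<bar>v\<bar>) * indicator {\<alpha>..\<beta>} t"
    by (auto simp: trig_def indicator_def)
qed auto

lemma trig_in_Lp: "1 \<le> p \<Longrightarrow> trig u v \<in> Lp p"
  using le_less_trans[OF trig_norm_le[of p u v]] by (simp add: Lp_def trig_measurable)

text \<open>
  The operator on the left has rank at most one, so its norm is bounded by the norm of the truncated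
  sine times the norm of the functional \<open>cos_moment\<close>. These two bounds are the factors of \<open>lambda_tilde\<close>.
\<close>

lemma cos_moment_trig_norm_le:
  assumes p: "1 \<le> p" and x: "x \<in> Lp p"
  shows "Lp_norm p (trig (k * cos_moment x) 0) \<le> ennreal (\<bar>k\<bar> * lambda_tilde p \<alpha>\<^sub>1 \<beta>\<^sub>1 \<alpha> \<beta>) * Lp_norm p x"
proof -
  let ?l = "(\<beta> - \<alpha>) powr (1 / enn2real p)"
  have "Lp_norm p (trig (k * cos_moment x) 0) \<le> ennreal (\<bar>k\<bar> * ?l) * ennreal \<bar>cos_moment x\<bar>"
    using trig_norm_le[OF p, of "k * cos_moment x" 0]
    by (simp add: abs_mult ennreal_mult'[symmetric] mult_ac)
  also have "\<dots> \<le> ennreal (\<bar>k\<bar> * ?l) * (ennreal ((\<beta>\<^sub>1 - \<alpha>\<^sub>1) powr (1 - 1 / enn2real p)) * Lp_norm p x)"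
    by (intro mult_left_mono cos_moment_bound p x) auto
  finally show ?thesis
    by (simp add: lambda_tilde_eq[OF p less outer_less] ennreal_mult' mult_ac)
qed

text \<open>
  Expanding the kernel needs the integrability of \<open>x\<close> on \<open>[\<alpha>\<^sub>1,\<beta>\<^sub>1]\<close>, which holds for \<open>x \<in> L\<^sub>p\<close>. The result
  is an equality at every point, so all later identities hold pointwise and not only almost everywhere.
\<close>

lemma op_A_eq_trig:
  assumes "1 \<le> p" "x \<in> Lp p"
  shows "op_A \<theta>A1 \<alpha>\<^sub>1 \<beta>\<^sub>1 \<alpha> \<beta> s1 s2 \<delta> \<omega> x
    = trig (\<theta>A1 * cos_moment x + sin_moment x / (\<delta> * s1)) (- cos_moment x / (\<delta> * s2))"
proof
  fix t
  let ?i = "indicator {\<alpha>..\<beta>} t :: real"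
  let ?u = "?i * (\<theta>A1 * sin (\<omega> * t) - 1 / (\<delta> * s2) * cos (\<omega> * t))"
  let ?v = "?i * (1 / (\<delta> * s1) * sin (\<omega> * t))"
  have "op_A \<theta>A1 \<alpha>\<^sub>1 \<beta>\<^sub>1 \<alpha> \<beta> s1 s2 \<delta> \<omega> x t
      = (LINT s:{\<alpha>\<^sub>1..\<beta>\<^sub>1}|lebesgue. ?u * (cos (\<omega> * s) * x s) + ?v * (sin (\<omega> * s) * x s))"
    unfolding op_A_def int_op_def by (simp add: algebra_simps)
  also have "\<dots> = ?u * cos_moment x + ?v * sin_moment x"
    using set_integrable_sin_cos[OF assms]
    by (subst set_integral_add(2)) (auto simp: cos_moment_def sin_moment_def simp del: set_integrable_mult_right_iff)
  finally show "op_A \<theta>A1 \<alpha>\<^sub>1 \<beta>\<^sub>1 \<alpha> \<beta> s1 s2 \<delta> \<omega> x t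
      = trig (\<theta>A1 * cos_moment x + sin_moment x / (\<delta> * s1)) (- cos_moment x / (\<delta> * s2)) t"
    by (simp add: trig_def algebra_simps)
qed

lemma op_B_eq_trig:
  assumes "1 \<le> p" "x \<in> Lp p"
  shows "op_B \<theta>B1 \<theta>B3 \<alpha>\<^sub>1 \<beta>\<^sub>1 \<alpha> \<beta> \<omega> x = trig (\<theta>B1 * cos_moment x + \<theta>B3 * sin_moment x) 0"
proof
  fix t
  let ?i = "indicator {\<alpha>..\<beta>} t * sin (\<omega> * t) :: real"
  have "op_B \<theta>B1 \<theta>B3 \<alpha>\<^sub>1 \<beta>\<^sub>1 \<alpha> \<beta> \<omega> x t
      = (LINT s:{\<alpha>\<^sub>1..\<beta>\<^sub>1}|lebesgue. (?i * \<theta>B1) * (cos (\<omega> * s) * x s) + (?i * \<theta>B3) * (sin (\<omega> * s) * x s))"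
    unfolding op_B_def int_op_def by (simp add: algebra_simps)
  also have "\<dots> = ?i * \<theta>B1 * cos_moment x + ?i * \<theta>B3 * sin_moment x"
    using set_integrable_sin_cos[OF assms]
    by (subst set_integral_add(2)) (auto simp: cos_moment_def sin_moment_def simp del: set_integrable_mult_right_iff)
  finally show "op_B \<theta>B1 \<theta>B3 \<alpha>\<^sub>1 \<beta>\<^sub>1 \<alpha> \<beta> \<omega> x t = trig (\<theta>B1 * cos_moment x + \<theta>B3 * sin_moment x) 0 t"
    by (simp add: trig_def algebra_simps)
qed

lemma Lp_operatorI:
  assumes T: "\<And>x. x \<in> Lp p \<Longrightarrow> T x = F (sin_moment x) (cos_moment x)" and F: "\<And>a b. F a b \<in> Lp p"
  shows "Lp_operator p T"
  unfolding Lp_operator_def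
proof (intro conjI ballI impI)
  fix x y assume "x \<in> Lp p" "y \<in> Lp p" "AE t in lebesgue. x t = y t"
  then have "T x = T y" using sin_cos_moment_cong_AE[of x p y] T by simp
  then show "AE t in lebesgue. T x t = T y t" by simp
qed (simp add: T F)

lemma Lp_operator_op_A:
  assumes "1 \<le> p"
  shows "Lp_operator p (op_A \<theta>A1 \<alpha>\<^sub>1 \<beta>\<^sub>1 \<alpha> \<beta> s1 s2 \<delta> \<omega>)"
  by (rule Lp_operatorI[where F = "\<lambda>a b. trig (\<theta>A1 * b + a / (\<delta> * s1)) (- b / (\<delta> * s2))"])
     (use assms in \<open>simp_all add: op_A_eq_trig trig_in_Lp\<close>)

lemma Lp_operator_op_B:
  assumes "1 \<le> p"
  shows "Lp_operator p (op_B \<theta>B1 \<theta>B3 \<alpha>\<^sub>1 \<beta>\<^sub>1 \<alpha> \<beta> \<omega>)"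
  by (rule Lp_operatorI[where F = "\<lambda>a b. trig (\<theta>B1 * b + \<theta>B3 * a) 0"])
     (use assms in \<open>simp_all add: op_B_eq_trig trig_in_Lp\<close>)

lemma op_B_diff:
  assumes "1 \<le> p" "x \<in> Lp p"
  shows "op_diff (op_B b \<theta>B3 \<alpha>\<^sub>1 \<beta>\<^sub>1 \<alpha> \<beta> \<omega>) (op_B b' \<theta>B3 \<alpha>\<^sub>1 \<beta>\<^sub>1 \<alpha> \<beta> \<omega>) x = trig ((b - b') * cos_moment x) 0"
  by (auto simp: op_diff_def op_B_eq_trig[OF assms] trig_def algebra_simps)

lemma tendsto_in_norm_trig:
  assumes p: "1 \<le> p" and k: "k \<longlonglongrightarrow> 0"
    and T: "\<And>n x. x \<in> Lp p \<Longrightarrow> op_diff (T n) T' x = trig (k n * cos_moment x) 0"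
  shows "tendsto_in_norm p T T'"
  unfolding tendsto_in_norm_def
proof (rule tendsto_sandwich[OF _ _ tendsto_const])
  let ?c = "\<lambda>n. ennreal (\<bar>k n\<bar> * lambda_tilde p \<alpha>\<^sub>1 \<beta>\<^sub>1 \<alpha> \<beta>)"
  have "Lp_opnorm p (op_diff (T n) T') \<le> ?c n" for n
    unfolding Lp_opnorm_def
  proof (rule SUP_least)
    fix x assume x: "x \<in> {x \<in> Lp p. Lp_norm p x \<le> 1}"
    then have "Lp_norm p (op_diff (T n) T' x) \<le> ?c n * Lp_norm p x"
      using cos_moment_trig_norm_le[OF p] T by simp
    also have "\<dots> \<le> ?c n * 1"
      using x by (intro mult_left_mono) auto
    finally show "Lp_norm p (op_diff (T n) T' x) \<le> ?c n" by simp
  qed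
  then show "eventually (\<lambda>n. Lp_opnorm p (op_diff (T n) T') \<le> ?c n) sequentially" by simp
  have "(\<lambda>n. \<bar>k n\<bar> * lambda_tilde p \<alpha>\<^sub>1 \<beta>\<^sub>1 \<alpha> \<beta>) \<longlonglongrightarrow> \<bar>0\<bar> * lambda_tilde p \<alpha>\<^sub>1 \<beta>\<^sub>1 \<alpha> \<beta>"
    by (intro tendsto_intros k)
  then show "?c \<longlonglongrightarrow> 0"
    using tendsto_ennrealI by force
qed simp

end

section \<open>Composition under orthogonality of sine and cosine\<close>

locale orthogonal_intervals = nested_intervals +
  assumes orth: "(LINT s:{\<alpha>\<^sub>1..\<beta>\<^sub>1}|lebesgue. sin (\<omega> * s) * cos (\<omega> * s)) = 0"
    and \<sigma>\<^sub>1_nz: "\<sigma>\<^sub>1 \<noteq> 0" and \<sigma>\<^sub>2_nz: "\<sigma>\<^sub>2 \<noteq> 0"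
begin

text \<open>
  The truncation to \<open>[\<alpha>,\<beta>]\<close> is invisible on the smaller interval \<open>[\<alpha>\<^sub>1,\<beta>\<^sub>1]\<close>, and orthogonality removes
  the mixed term.
\<close>

lemma sin_moment_trig: "sin_moment (trig u v) = u * \<sigma>\<^sub>1"
  and cos_moment_trig: "cos_moment (trig u v) = v * \<sigma>\<^sub>2"
proof -
  have inner: "indicator {\<alpha>..\<beta>} s = (1::real)" if "s \<in> {\<alpha>\<^sub>1..\<beta>\<^sub>1}" for s
    using that lower upper by (auto simp: indicator_def)
  have int: "set_integrable lebesgue {\<alpha>\<^sub>1..\<beta>\<^sub>1} (\<lambda>s. k * (sin (\<omega> * s))\<^sup>2)"
     "set_integrable lebesgue {\<alpha>\<^sub>1..\<beta>\<^sub>1} (\<lambda>s. k * (sin (\<omega> * s) * cos (\<omega> * s)))"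
     "set_integrable lebesgue {\<alpha>\<^sub>1..\<beta>\<^sub>1} (\<lambda>s. k * (cos (\<omega> * s))\<^sup>2)" for k
    by (intro absolutely_integrable_continuous_real continuous_intros)+
  have "sin_moment (trig u v) = (LINT s:{\<alpha>\<^sub>1..\<beta>\<^sub>1}|lebesgue.
      u * (sin (\<omega> * s))\<^sup>2 + v * (sin (\<omega> * s) * cos (\<omega> * s)))"
    unfolding sin_moment_def
    by (intro set_lebesgue_integral_cong) (auto simp: trig_def inner algebra_simps power2_eq_square)
  also have "\<dots> = u * \<sigma>\<^sub>1"
    by (subst set_integral_add(2)[OF int(1,2)]) (simp add: orth sigma1_def)
  finally show "sin_moment (trig u v) = u * \<sigma>\<^sub>1" .
  have "cos_moment (trig u v) = (LINT s:{\<alpha>\<^sub>1..\<beta>\<^sub>1}|lebesgue.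
      u * (sin (\<omega> * s) * cos (\<omega> * s)) + v * (cos (\<omega> * s))\<^sup>2)"
    unfolding cos_moment_def
    by (intro set_lebesgue_integral_cong) (auto simp: trig_def inner algebra_simps power2_eq_square)
  also have "\<dots> = v * \<sigma>\<^sub>2"
    by (subst set_integral_add(2)[OF int(2,3)]) (simp add: orth sigma2_def)
  finally show "cos_moment (trig u v) = v * \<sigma>\<^sub>2" .
qed

context
  fixes p :: ennreal and \<theta>A1 \<theta>B1 \<theta>B3 \<delta> :: real and A B :: fun_op and x :: "real \<Rightarrow> real"
  assumes p: "1 \<le> p" and \<delta>: "\<delta> \<noteq> 0" and x: "x \<in> Lp p"
  defines "A \<equiv> op_A \<theta>A1 \<alpha>\<^sub>1 \<beta>\<^sub>1 \<alpha> \<beta> \<sigma>\<^sub>1 \<sigma>\<^sub>2 \<delta> \<omega>"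
    and "B \<equiv> op_B \<theta>B1 \<theta>B3 \<alpha>\<^sub>1 \<beta>\<^sub>1 \<alpha> \<beta> \<omega>"
begin

text \<open>
  On coefficient pairs, \<open>A\<close> maps \<open>(u, v)\<close> to \<open>(\<theta>\<^sub>A\<^sub>1 v \<sigma>\<^sub>2 + u/\<delta>, - v/\<delta>)\<close> and \<open>B\<close> maps it to
  \<open>(\<theta>\<^sub>B\<^sub>1 v \<sigma>\<^sub>2 + \<theta>\<^sub>B\<^sub>3 u \<sigma>\<^sub>1, 0)\<close>. The opposite signs of the two diagonal entries of \<open>A\<close> make its square
  scalar, and the same sign change doubles \<open>\<theta>\<^sub>B\<^sub>1\<close> in the commutator.
\<close>

lemma twisted_commutation: "(A \<circ> B) x = op_scale \<delta> (B \<circ> A \<circ> A) x"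
  and commutator_eq: "op_diff (A \<circ> B) (B \<circ> A) x = trig ((2 * \<theta>B1 / \<delta> - \<theta>A1 * \<theta>B3 * \<sigma>\<^sub>1) * cos_moment x) 0"
proof -
  let ?u = "\<theta>A1 * cos_moment x + sin_moment x / (\<delta> * \<sigma>\<^sub>1)" and ?v = "- cos_moment x / (\<delta> * \<sigma>\<^sub>2)"
  have nz: "\<sigma>\<^sub>1 \<noteq> 0" "\<sigma>\<^sub>2 \<noteq> 0" "\<delta> \<noteq> 0"
    using \<sigma>\<^sub>1_nz \<sigma>\<^sub>2_nz \<delta> by auto
  have A: "A (trig u v) = trig (\<theta>A1 * v * \<sigma>\<^sub>2 + u / \<delta>) (- v / \<delta>)" for u v
    using nz by (simp add: A_def op_A_eq_trig[OF p trig_in_Lp[OF p]] sin_moment_trig cos_moment_trig mult_ac)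
  have B: "B (trig u v) = trig (\<theta>B1 * v * \<sigma>\<^sub>2 + \<theta>B3 * u * \<sigma>\<^sub>1) 0" for u v
    by (simp add: B_def op_B_eq_trig[OF p trig_in_Lp[OF p]] sin_moment_trig cos_moment_trig mult_ac)
  have Ax: "A x = trig ?u ?v" by (simp add: A_def op_A_eq_trig[OF p x])
  have Bx: "B x = trig (\<theta>B1 * cos_moment x + \<theta>B3 * sin_moment x) 0" by (simp add: B_def op_B_eq_trig[OF p x])
  have AB: "A (B x) = trig ((\<theta>B1 * cos_moment x + \<theta>B3 * sin_moment x) / \<delta>) 0"
    by (simp add: A Bx)
  have BAA: "B (A (A x)) = trig ((\<theta>B1 * cos_moment x + \<theta>B3 * sin_moment x) / \<delta>\<^sup>2) 0"
    unfolding Ax A B using nz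
    by (intro arg_cong2[where f = trig]) (simp_all add: field_simps power2_eq_square)
  show "(A \<circ> B) x = op_scale \<delta> (B \<circ> A \<circ> A) x"
    using nz by (simp add: op_scale_def AB BAA trig_def fun_eq_iff power2_eq_square)
  have BA: "B (A x) = trig (- \<theta>B1 * cos_moment x / \<delta> + \<theta>B3 * (\<theta>A1 * \<sigma>\<^sub>1 * cos_moment x + sin_moment x / \<delta>)) 0"
    unfolding Ax B using nz
    by (intro arg_cong2[where f = trig]) (simp_all add: field_simps)
  show "op_diff (A \<circ> B) (B \<circ> A) x = trig ((2 * \<theta>B1 / \<delta> - \<theta>A1 * \<theta>B3 * \<sigma>\<^sub>1) * cos_moment x) 0"
    using nz by (simp add: op_diff_def AB BA trig_def fun_eq_iff field_simps)
qed

end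

end

section \<open>Dependence on the parameters\<close>

text \<open>
  A parameter vector has the value \<open>\<beta>\<^sub>1 - \<alpha>\<^sub>1 - \<sigma>\<^sub>1\<close> as its coordinate \<open>\<sigma>\<^sub>2\<close>, which is the integral of
  \<open>cos\<^sup>2\<close>; hence the commutator formula applies to it. The bound involves the parameters only through the quantity
  whose convergence to 0 is supposed.
\<close>

lemma commutator_norm_le:
  fixes p :: ennreal
  assumes p: "1 \<le> p" and x: "x \<in> Lp p"
    and mem: "(\<theta>A1, \<theta>B1, \<theta>B3, \<alpha>\<^sub>1, \<beta>\<^sub>1, \<alpha>, \<beta>, \<sigma>\<^sub>1, \<sigma>\<^sub>2, \<delta>, \<omega>) \<in> param_set"
  defines "A \<equiv> op_A \<theta>A1 \<alpha>\<^sub>1 \<beta>\<^sub>1 \<alpha> \<beta> \<sigma>\<^sub>1 \<sigma>\<^sub>2 \<delta> \<omega>" and "B \<equiv> op_B \<theta>B1 \<theta>B3 \<alpha>\<^sub>1 \<beta>\<^sub>1 \<alpha> \<beta> \<omega>"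
  shows "Lp_norm p (op_diff (A \<circ> B) (B \<circ> A) x)
    \<le> Lp_norm p x * ennreal \<bar>(2 * \<theta>B1 / \<delta> - \<theta>A1 * \<theta>B3 * \<sigma>\<^sub>1) * lambda_tilde p \<alpha>\<^sub>1 \<beta>\<^sub>1 \<alpha> \<beta>\<bar>"
proof -
  have h: "\<delta> \<noteq> 0" "\<alpha>\<^sub>1 < \<beta>\<^sub>1" "\<alpha> \<le> \<alpha>\<^sub>1" "\<beta>\<^sub>1 \<le> \<beta>"
    "(LINT s:{\<alpha>\<^sub>1..\<beta>\<^sub>1}|lebesgue. sin (\<omega> * s) * cos (\<omega> * s)) = 0"
    "\<sigma>\<^sub>1 = sigma1 \<alpha>\<^sub>1 \<beta>\<^sub>1 \<omega>" "\<sigma>\<^sub>1 \<noteq> 0" "\<sigma>\<^sub>2 \<noteq> 0" "\<sigma>\<^sub>2 = \<beta>\<^sub>1 - \<alpha>\<^sub>1 - \<sigma>\<^sub>1"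
    using mem by (auto simp: param_set_def sigma1_def)
  have s2: "\<sigma>\<^sub>2 = sigma2 \<alpha>\<^sub>1 \<beta>\<^sub>1 \<omega>"
    using sigma1_plus_sigma2[of \<alpha>\<^sub>1 \<beta>\<^sub>1 \<omega>] h by linarith
  interpret orthogonal_intervals \<alpha>\<^sub>1 \<beta>\<^sub>1 \<alpha> \<beta> \<omega>
    by unfold_locales (use h s2 in auto)
  let ?k = "2 * \<theta>B1 / \<delta> - \<theta>A1 * \<theta>B3 * \<sigma>\<^sub>1"
  have "0 \<le> lambda_tilde p \<alpha>\<^sub>1 \<beta>\<^sub>1 \<alpha> \<beta>"
    by (simp add: lambda_tilde_eq[OF p less outer_less])
  moreover have "op_diff (A \<circ> B) (B \<circ> A) x = trig (?k * cos_moment x) 0"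
    unfolding A_def B_def h(6) s2 by (rule commutator_eq[OF p h(1) x])
  ultimately show ?thesis
    using cos_moment_trig_norm_le[OF p x, of ?k] by (simp add: abs_mult mult.commute)
qed

theorem theorem4:
  fixes p :: ennreal
    and \<theta>A1 \<theta>B1 \<theta>B3 \<omega> \<delta> \<alpha> \<beta> \<alpha>\<^sub>1 \<beta>\<^sub>1 \<sigma>\<^sub>1 \<sigma>\<^sub>2 :: real
    and \<zeta> :: "nat \<Rightarrow> real"
    and A B B' :: fun_op
    and Bn :: "nat \<Rightarrow> fun_op"
  assumes "1 \<le> p"
    and "\<delta> \<noteq> 0" and "\<alpha>\<^sub>1 < \<beta>\<^sub>1" and "\<alpha> \<le> \<alpha>\<^sub>1" and "\<beta> \<ge> \<beta>\<^sub>1"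
    and "\<omega> / pi * (\<beta>\<^sub>1 - \<alpha>\<^sub>1) \<in> \<int> \<or> \<omega> / pi * (\<beta>\<^sub>1 + \<alpha>\<^sub>1) \<in> \<int>"
    and "\<sigma>\<^sub>1 = sigma1 \<alpha>\<^sub>1 \<beta>\<^sub>1 \<omega>" and "\<sigma>\<^sub>2 = sigma2 \<alpha>\<^sub>1 \<beta>\<^sub>1 \<omega>"
    and "\<sigma>\<^sub>1 \<noteq> 0" and "\<sigma>\<^sub>2 \<noteq> 0"
    and "A = op_A \<theta>A1 \<alpha>\<^sub>1 \<beta>\<^sub>1 \<alpha> \<beta> \<sigma>\<^sub>1 \<sigma>\<^sub>2 \<delta> \<omega>"
    and "B = op_B \<theta>B1 \<theta>B3 \<alpha>\<^sub>1 \<beta>\<^sub>1 \<alpha> \<beta> \<omega>"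
    and "\<And>n. Bn n = op_B (\<zeta> n) \<theta>B3 \<alpha>\<^sub>1 \<beta>\<^sub>1 \<alpha> \<beta> \<omega>"
    and "B' = op_B (\<delta> / 2 * \<theta>A1 * \<theta>B3 * \<sigma>\<^sub>1) \<theta>B3 \<alpha>\<^sub>1 \<beta>\<^sub>1 \<alpha> \<beta> \<omega>"
  shows
    "(Lp_operator p A \<and> Lp_operator p B \<and> (\<forall>n\<ge>1. Lp_operator p (Bn n)) \<and> Lp_operator p B')
     \<and>
     (Lp_op_eq p (A \<circ> B) (op_scale \<delta> (B \<circ> A \<circ> A)) \<and>
      (\<forall>n\<ge>1. Lp_op_eq p (A \<circ> Bn n) (op_scale \<delta> (Bn n \<circ> A \<circ> A))) \<and>
      (\<forall>x\<in>Lp p. AE t in lebesgue.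
         op_diff (A \<circ> B) (B \<circ> A) x t =
           (2 * \<theta>B1 / \<delta> - \<theta>A1 * \<theta>B3 * \<sigma>\<^sub>1) *
           (LINT s:{\<alpha>\<^sub>1..\<beta>\<^sub>1}|lebesgue. indicator {\<alpha>..\<beta>} t * sin (\<omega> * t) * cos (\<omega> * s) * x s)))
     \<and>
     (\<zeta> \<longlonglongrightarrow> \<delta> / 2 * \<theta>A1 * \<theta>B3 * \<sigma>\<^sub>1 \<longrightarrow>
        tendsto_in_norm p Bn B' \<and>
        tendsto_in_norm p (\<lambda>n. op_diff (A \<circ> Bn n) (Bn n \<circ> A)) (\<lambda>x t. 0) \<and>
        Lp_op_eq p (A \<circ> B') (B' \<circ> A))
     \<and>
     (\<forall>l\<^sub>0 \<in> closure param_set.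
        ((\<lambda>(\<theta>A1, \<theta>B1, \<theta>B3, \<alpha>\<^sub>1, \<beta>\<^sub>1, \<alpha>, \<beta>, \<sigma>\<^sub>1, \<sigma>\<^sub>2, \<delta>, \<omega>).
            (2 * \<theta>B1 / \<delta> - \<theta>A1 * \<theta>B3 * \<sigma>\<^sub>1) * lambda_tilde p \<alpha>\<^sub>1 \<beta>\<^sub>1 \<alpha> \<beta>)
          \<longlongrightarrow> 0) (at l\<^sub>0 within param_set) \<longrightarrow>
        (\<forall>x\<in>Lp p.
          ((\<lambda>(\<theta>A1, \<theta>B1, \<theta>B3, \<alpha>\<^sub>1, \<beta>\<^sub>1, \<alpha>, \<beta>, \<sigma>\<^sub>1, \<sigma>\<^sub>2, \<delta>, \<omega>).
              let A = op_A \<theta>A1 \<alpha>\<^sub>1 \<beta>\<^sub>1 \<alpha> \<beta> \<sigma>\<^sub>1 \<sigma>\<^sub>2 \<delta> \<omega>;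
                  B = op_B \<theta>B1 \<theta>B3 \<alpha>\<^sub>1 \<beta>\<^sub>1 \<alpha> \<beta> \<omega>
              in Lp_norm p (op_diff (A \<circ> B) (B \<circ> A) x))
            \<longlongrightarrow> 0) (at l\<^sub>0 within param_set)))"
proof -
  interpret orthogonal_intervals \<alpha>\<^sub>1 \<beta>\<^sub>1 \<alpha> \<beta> \<omega>
    by unfold_locales (use assms sin_mult_cos_set_integral_eq_0[of \<alpha>\<^sub>1 \<beta>\<^sub>1 \<omega>] in auto)
  note p = \<open>1 \<le> p\<close> and d = \<open>\<delta> \<noteq> 0\<close>
  note ops = assms(7,8,11-14)
  have comm: "op_diff (A \<circ> op_B b \<theta>B3 \<alpha>\<^sub>1 \<beta>\<^sub>1 \<alpha> \<beta> \<omega>) (op_B b \<theta>B3 \<alpha>\<^sub>1 \<beta>\<^sub>1 \<alpha> \<beta> \<omega> \<circ> A) x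
      = trig ((2 * b / \<delta> - \<theta>A1 * \<theta>B3 * \<sigma>\<^sub>1) * cos_moment x) 0" if "x \<in> Lp p" for b x
    unfolding ops by (rule commutator_eq[OF p d that])
  show ?thesis
  proof (intro conjI impI ballI allI)
    show "Lp_operator p A" "Lp_operator p B" "Lp_operator p (Bn n)" "Lp_operator p B'" for n
      unfolding ops by (intro Lp_operator_op_A Lp_operator_op_B p)+
    show "Lp_op_eq p (A \<circ> B) (op_scale \<delta> (B \<circ> A \<circ> A))"
      "Lp_op_eq p (A \<circ> Bn n) (op_scale \<delta> (Bn n \<circ> A \<circ> A))" for n
      unfolding ops Lp_op_eq_def by (intro ballI AE_I2 fun_cong[OF twisted_commutation[OF p d]]; assumption)+
    fix x assume x: "x \<in> Lp p"
    show "AE t in lebesgue. op_diff (A \<circ> B) (B \<circ> A) x t =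
        (2 * \<theta>B1 / \<delta> - \<theta>A1 * \<theta>B3 * \<sigma>\<^sub>1) *
        (LINT s:{\<alpha>\<^sub>1..\<beta>\<^sub>1}|lebesgue. indicator {\<alpha>..\<beta>} t * sin (\<omega> * t) * cos (\<omega> * s) * x s)"
    proof (rule AE_I2)
      fix t
      show "op_diff (A \<circ> B) (B \<circ> A) x t =
        (2 * \<theta>B1 / \<delta> - \<theta>A1 * \<theta>B3 * \<sigma>\<^sub>1) *
        (LINT s:{\<alpha>\<^sub>1..\<beta>\<^sub>1}|lebesgue. indicator {\<alpha>..\<beta>} t * sin (\<omega> * t) * cos (\<omega> * s) * x s)"
        using comm[OF x, of \<theta>B1] by (simp add: assms(12) trig_def cos_moment_def mult.assoc)
    qed
  next
    \<comment> \<open>The coefficient \<open>c\<close> of \<open>B'\<close> is the zero of the commutator factor \<open>2 b / \<delta> - \<theta>\<^sub>A\<^sub>1 \<theta>\<^sub>B\<^sub>3 \<sigma>\<^sub>1\<close>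
      as a function of \<open>b\<close>.\<close>
    define c where "c = \<delta> / 2 * \<theta>A1 * \<theta>B3 * \<sigma>\<^sub>1"
    assume "\<zeta> \<longlonglongrightarrow> \<delta> / 2 * \<theta>A1 * \<theta>B3 * \<sigma>\<^sub>1"
    then have lim: "\<zeta> \<longlonglongrightarrow> c" by (simp add: c_def)
    show "tendsto_in_norm p Bn B'"
    proof (rule tendsto_in_norm_trig[OF p])
      show "(\<lambda>n. \<zeta> n - c) \<longlonglongrightarrow> 0" using lim by (simp add: LIM_zero)
    qed (simp add: assms(13,14) op_B_diff[OF p] c_def)
    show "tendsto_in_norm p (\<lambda>n. op_diff (A \<circ> Bn n) (Bn n \<circ> A)) (\<lambda>x t. 0)"
    proof (rule tendsto_in_norm_trig[OF p])
      have "(\<lambda>n. 2 * \<zeta> n / \<delta> - \<theta>A1 * \<theta>B3 * \<sigma>\<^sub>1) \<longlonglongrightarrow> 2 * c / \<delta> - \<theta>A1 * \<theta>B3 * \<sigma>\<^sub>1"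
        by (intro tendsto_intros lim d)
      then show "(\<lambda>n. 2 * \<zeta> n / \<delta> - \<theta>A1 * \<theta>B3 * \<sigma>\<^sub>1) \<longlonglongrightarrow> 0"
        using d by (simp add: c_def)
      show "op_diff (op_diff (A \<circ> Bn n) (Bn n \<circ> A)) (\<lambda>x t. 0) x
          = trig ((2 * \<zeta> n / \<delta> - \<theta>A1 * \<theta>B3 * \<sigma>\<^sub>1) * cos_moment x) 0" if "x \<in> Lp p" for n x
        using comm[OF that, of "\<zeta> n"] by (simp add: assms(13) op_diff_def)
    qed
    show "Lp_op_eq p (A \<circ> B') (B' \<circ> A)"
      unfolding Lp_op_eq_def
    proof (intro ballI AE_I2)
      fix x t assume x: "x \<in> Lp p"
      have "2 * c / \<delta> - \<theta>A1 * \<theta>B3 * \<sigma>\<^sub>1 = 0" using d by (simp add: c_def)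
      then show "(A \<circ> B') x t = (B' \<circ> A) x t"
        using fun_cong[OF comm[OF x, of c], of t] by (simp add: assms(14) c_def op_diff_def trig_def)
    qed
  next
    fix l\<^sub>0 x
    let ?k = "\<lambda>(\<theta>A1, \<theta>B1, \<theta>B3, \<alpha>\<^sub>1, \<beta>\<^sub>1, \<alpha>, \<beta>, \<sigma>\<^sub>1, \<sigma>\<^sub>2, \<delta>, \<omega>).
      (2 * \<theta>B1 / \<delta> - \<theta>A1 * \<theta>B3 * \<sigma>\<^sub>1) * lambda_tilde p \<alpha>\<^sub>1 \<beta>\<^sub>1 \<alpha> \<beta>"
    let ?N = "\<lambda>(\<theta>A1, \<theta>B1, \<theta>B3, \<alpha>\<^sub>1, \<beta>\<^sub>1, \<alpha>, \<beta>, \<sigma>\<^sub>1, \<sigma>\<^sub>2, \<delta>, \<omega>).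
      let A = op_A \<theta>A1 \<alpha>\<^sub>1 \<beta>\<^sub>1 \<alpha> \<beta> \<sigma>\<^sub>1 \<sigma>\<^sub>2 \<delta> \<omega>; B = op_B \<theta>B1 \<theta>B3 \<alpha>\<^sub>1 \<beta>\<^sub>1 \<alpha> \<beta> \<omega>
      in Lp_norm p (op_diff (A \<circ> B) (B \<circ> A) x)"
    assume lim: "(?k \<longlongrightarrow> 0) (at l\<^sub>0 within param_set)" and x: "x \<in> Lp p"
    have "?N l \<le> Lp_norm p x * ennreal \<bar>?k l\<bar>" if "l \<in> param_set" for l
      using that by (auto simp: Let_def commutator_norm_le[OF \<open>1 \<le> p\<close> x] split: prod.split)
    then have le: "\<forall>\<^sub>F l in at l\<^sub>0 within param_set. ?N l \<le> Lp_norm p x * ennreal \<bar>?k l\<bar>"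
      by (simp add: eventually_at_filter)
    have "((\<lambda>l. Lp_norm p x * ennreal \<bar>?k l\<bar>) \<longlongrightarrow> Lp_norm p x * ennreal \<bar>0\<bar>) (at l\<^sub>0 within param_set)"
      using x by (intro ennreal_tendsto_cmult tendsto_ennrealI tendsto_rabs lim) (simp add: Lp_def)
    then show "(?N \<longlongrightarrow> 0) (at l\<^sub>0 within param_set)"
      by (intro tendsto_sandwich[OF _ le tendsto_const]) auto
  qed
qed

end
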